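(* Let $N\ge1$ be an integer, $0<\gamma<N$ a real number, $p=\frac N\gamma$, $0\le\beta<N$, $a,b>0$, and $$\beta_0(N,\gamma)=\frac{N}{\omega_{N-1}}\left[\frac{\pi^{\frac N2}2^\gamma\Gamma\left(\frac\gamma2\right)}{\Gamma\left(\frac{N-\gamma}{2}\right)}\right]^{\frac{p}{p-1}}.$$ For $0\le\alpha<\beta_0(N,\gamma)$ define $$GATA(\alpha,\beta)=\sup_{\|(-\Delta)^{\gamma/2}u\|_p\le1}\frac{1}{\|u\|_p^{p\left(1-\frac\beta N\right)}}\int_{\mathbb{R}^N}\frac{\phi_{N,\gamma}\left(\alpha\left(1-\frac\beta N\right)|u|^{\frac{p}{p-1}}\right)}{|x|^\beta}\,dx,$$ the supremum being over $u\in W^{\gamma,p}(\mathbb{R}^N)\setminus\{0\}$ with $\|(-\Delta)^{\gamma/2}u\|_p\le1$, and define $$GA_{a,b}(\beta)=\sup_{\|(-\Delta)^{\gamma/2}u\|_p^a+\|u\|_p^b\le1}\int_{\mathbb{R}^N}\frac{\phi_{N,\gamma}\left(\beta_0(N,\gamma)\left(1-\frac\beta N\right)|u|^{\frac{p}{p-1}}\right)}{|x|^\beta}\,dx,$$ the supremum being over $u\in W^{\gamma,p}(\mathbb{R}^N)$ with $\|(-\Delta)^{\gamma/2}u\|_p^a+\|u\|_p^b\le1$. Assume that $GATA(\alpha,\beta)<\infty$ for all $0\le\alpha<\beta_0(N,\gamma)$ and that there exists a constant $C(N,\gamma,\beta)>0$ such that for all $0\le\alpha<\beta_0(N,\gamma)$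 $$GATA(\alpha,\beta)\le\frac{C(N,\gamma,\beta)}{\left(1-\left(\frac{\alpha}{\beta_0(N,\gamma)}\right)^{\frac{p-1}{p}}\right)^{1-\frac\beta N}}.$$ Then, if $b\le p$, we have $GA_{a,b}(\beta)<\infty$. In particular, $GA_{p,p}(\beta)<\infty$.
   Context: $\phi_{N,\gamma}(t)=\sum_{j\in\mathbb{N}:\,j\ge p-1}\frac{t^j}{j!}$. $\omega_{N-1}$ is the surface area of the unit sphere in $\mathbb{R}^N$. $\|\cdot\|_p$ is the $L^p(\mathbb{R}^N)$ norm. $W^{\gamma,p}(\mathbb{R}^N)$ is the fractional Sobolev (Bessel potential) space of $u\in L^p(\mathbb{R}^N)$ with $(I-\Delta)^{\gamma/2}u\in L^p(\mathbb{R}^N)$, and $(-\Delta)^{\gamma/2}$ is the Fourier multiplier operator with symbol $|\xi|^\gamma$ (up to the usual Fourier normalization, chosen so that for $\gamma=2$ it is $-\Delta$). *)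

theory Defs
  imports "HOL-Analysis.Analysis"
begin

section \<open>Lebesgue spaces\<close>

text \<open>Functions are real-valued and represent their classes modulo equality almost everywhere.\<close>

definition Lp_space :: "real \<Rightarrow> ('a::euclidean_space \<Rightarrow> real) set" where
  "Lp_space p = {u \<in> borel_measurable lborel. integrable lborel (\<lambda>x. \<bar>u x\<bar> powr p)}"

definition Lp_norm :: "real \<Rightarrow> ('a::euclidean_space \<Rightarrow> real) \<Rightarrow> real" where
  "Lp_norm p u = (\<integral>x. \<bar>u x\<bar> powr p \<partial>lborel) powr (1 / p)"

section \<open>Schwartz functions and Fourier multipliers\<close>

fun iter_partial :: "'a list \<Rightarrow> ('a::euclidean_space \<Rightarrow> complex) \<Rightarrow> 'a \<Rightarrow> complex" where
  "iter_partial [] f = f"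
| "iter_partial (e # es) f = (\<lambda>x. frechet_derivative (iter_partial es f) (at x) e)"

definition schwartz :: "('a::euclidean_space \<Rightarrow> complex) set" where
  "schwartz = {f. \<forall>es \<in> lists Basis.
      (\<forall>x. iter_partial es f differentiable (at x)) \<and>
      (\<forall>k::nat. bounded (range (\<lambda>x. norm x ^ k *\<^sub>R iter_partial es f x)))}"

definition fourier :: "('a::euclidean_space \<Rightarrow> complex) \<Rightarrow> 'a \<Rightarrow> complex" where
  "fourier f \<xi> = (\<integral>x. cis (- (x \<bullet> \<xi>)) * f x \<partial>lborel)"

definition inverse_fourier :: "('a::euclidean_space \<Rightarrow> complex) \<Rightarrow> 'a \<Rightarrow> complex" where
  "inverse_fourier g x =
     complex_of_real (1 / (2 * pi) ^ DIM('a)) * (\<integral>\<xi>. cis (x \<bullet> \<xi>) * g \<xi> \<partial>lborel)"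

definition schwartz_multiplier ::
    "('a::euclidean_space \<Rightarrow> real) \<Rightarrow> ('a \<Rightarrow> complex) \<Rightarrow> 'a \<Rightarrow> complex" where
  "schwartz_multiplier m f = inverse_fourier (\<lambda>\<xi>. complex_of_real (m \<xi>) * fourier f \<xi>)"

text \<open>
  \<open>has_multiplier m u v\<close> says that the Fourier multiplier operator with symbol \<open>m\<close> maps the
  tempered distribution \<open>u\<close> to \<open>v\<close>. The operator is transposed onto the test function; the
  transpose has symbol \<open>m(-\<xi>)\<close>. For the two symbols used below and \<open>f\<close> Schwartz,
  \<open>schwartz_multiplier m f\<close> lies in every \<open>L\<^sup>q\<close> with \<open>1 \<le> q\<close>, so that the
  left-hand integral converges for \<open>u \<in> L\<^sup>p\<close>. Among the
  functions in Lebesgue spaces, \<open>v\<close> is determined by \<open>u\<close> up to null sets.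
\<close>

definition has_multiplier ::
    "('a::euclidean_space \<Rightarrow> real) \<Rightarrow> ('a \<Rightarrow> real) \<Rightarrow> ('a \<Rightarrow> real) \<Rightarrow> bool" where
  "has_multiplier m u v \<longleftrightarrow> (\<forall>f \<in> schwartz.
     (\<integral>x. complex_of_real (u x) * schwartz_multiplier (\<lambda>\<xi>. m (- \<xi>)) f x \<partial>lborel)
     = (\<integral>x. complex_of_real (v x) * f x \<partial>lborel))"

section \<open>Bessel potential spaces and the fractional Laplacian\<close>

definition sobolev_space :: "real \<Rightarrow> real \<Rightarrow> ('a::euclidean_space \<Rightarrow> real) set" where
  "sobolev_space \<gamma> p = {u \<in> Lp_space p. \<exists>v \<in> Lp_space p.
     has_multiplier (\<lambda>\<xi>. (1 + (norm \<xi>)\<^sup>2) powr (\<gamma> / 2)) u v}"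

text \<open>
  \<open>has_frac_laplacian \<gamma> p u v\<close> says that \<open>v \<in> L\<^sup>p\<close> and \<open>(-\<Delta>)\<^bsup>\<gamma>/2\<^esup> u = v\<close>. Such a \<open>v\<close> is unique
  almost everywhere, and it exists for every \<open>u\<close> in \<open>sobolev_space \<gamma> p\<close> when
  \<open>1 < p\<close>, since \<open>|\<xi>|\<^bsup>\<gamma>\<^esup> (1 + |\<xi>|\<^sup>2)\<^bsup>-\<gamma>/2\<^esup>\<close> is then an \<open>L\<^sup>p\<close>-multiplier.
\<close>

definition has_frac_laplacian ::
    "real \<Rightarrow> real \<Rightarrow> ('a::euclidean_space \<Rightarrow> real) \<Rightarrow> ('a \<Rightarrow> real) \<Rightarrow> bool" where
  "has_frac_laplacian \<gamma> p u v \<longleftrightarrow>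
     v \<in> Lp_space p \<and> has_multiplier (\<lambda>\<xi>. norm \<xi> powr \<gamma>) u v"

section \<open>The Adams functionals\<close>

text \<open>The surface measure of a subset of the unit sphere of \<open>'a\<close> is \<open>DIM('a)\<close> times the volume
  of the cone over it; on the whole sphere this gives \<open>\<omega>\<^bsub>N-1\<^esub>\<close> for \<open>N = DIM('a)\<close>.\<close>

definition sphere_measure :: "'a::euclidean_space set \<Rightarrow> real" where
  "sphere_measure E = real DIM('a) * measure lborel {r *\<^sub>R x | r x. 0 < r \<and> r \<le> 1 \<and> x \<in> E}"

definition sphere_area :: "'a::euclidean_space itself \<Rightarrow> real" where
  "sphere_area _ = sphere_measure (sphere (0::'a) 1)"

definition adams_phi :: "nat \<Rightarrow> real \<Rightarrow> real \<Rightarrow> real" where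
  "adams_phi N \<gamma> t =
     (\<Sum>j. if real N / \<gamma> - 1 \<le> real j then t ^ j / fact j else 0)"

definition beta_0 :: "'a::euclidean_space itself \<Rightarrow> real \<Rightarrow> real" where
  "beta_0 T \<gamma> = (let N = real DIM('a); p = N / \<gamma> in
     N / sphere_area T *
     (pi powr (N / 2) * 2 powr \<gamma> * Gamma (\<gamma> / 2) / Gamma ((N - \<gamma>) / 2)) powr (p / (p - 1)))"

text \<open>The weight takes the value \<open>0\<close> at the origin in HOL (even for \<open>\<beta> = 0\<close>), a null set.\<close>

definition adams_integral :: "real \<Rightarrow> real \<Rightarrow> real \<Rightarrow> ('a::euclidean_space \<Rightarrow> real) \<Rightarrow> ennreal" where
  "adams_integral \<gamma> \<alpha> \<beta> u = (let N = DIM('a); p = real N / \<gamma> in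
     \<integral>\<^sup>+x. ennreal (adams_phi N \<gamma> (\<alpha> * (1 - \<beta> / real N) * \<bar>u x\<bar> powr (p / (p - 1)))
                   / norm x powr \<beta>) \<partial>lborel)"

definition GATA :: "'a::euclidean_space itself \<Rightarrow> real \<Rightarrow> real \<Rightarrow> real \<Rightarrow> ennreal" where
  "GATA _ \<gamma> \<alpha> \<beta> = (let N = real DIM('a); p = N / \<gamma> in
     SUP u \<in> {u :: 'a \<Rightarrow> real. u \<in> sobolev_space \<gamma> p \<and> \<not> (AE x in lborel. u x = 0) \<and>
               (\<exists>v. has_frac_laplacian \<gamma> p u v \<and> Lp_norm p v \<le> 1)}.
       adams_integral \<gamma> \<alpha> \<beta> u / ennreal (Lp_norm p u powr (p * (1 - \<beta> / N))))"

definition GA :: "'a::euclidean_space itself \<Rightarrow> real \<Rightarrow> real \<Rightarrow> real \<Rightarrow> real \<Rightarrow> ennreal" where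
  "GA T \<gamma> a b \<beta> = (let p = real DIM('a) / \<gamma> in
     SUP u \<in> {u :: 'a \<Rightarrow> real. u \<in> sobolev_space \<gamma> p \<and>
               (\<exists>v. has_frac_laplacian \<gamma> p u v \<and>
                    Lp_norm p v powr a + Lp_norm p u powr b \<le> 1)}.
       adams_integral \<gamma> (beta_0 T \<gamma>) \<beta> u)"

end

theory Submission
  imports Defs
begin

text \<open>
  Let \<open>\<theta> = \<parallel>(-\<Delta>)\<^bsup>\<gamma>/2\<^esup> u\<parallel>\<^sub>p\<close> and \<open>t = max \<theta> (1/2)\<close>. The function \<open>w = u / t\<close> is admissible
  for \<open>GATA\<close>, and its functional with parameter \<open>\<alpha> = \<beta>\<^sub>0 t\<^bsup>p/(p-1)\<^esup>\<close> is the critical functional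
  of \<open>u\<close>. The assumed bound on \<open>GATA\<close> therefore gives
  \<open>C (\<parallel>u\<parallel>\<^sub>p\<^sup>p / (t\<^sup>p (1 - t)))\<^bsup>1-\<beta>/N\<^esup>\<close>, and the constraint together with \<open>b \<le> p\<close> forces
  \<open>\<parallel>u\<parallel>\<^sub>p\<^sup>p\<close> to be at most a constant times \<open>1 - t\<close>. Because the quotient in \<open>GATA\<close> is invariant
  under dilations, \<open>u\<close> does not have to be dilated.
\<close>

section \<open>Homogeneity of norms, spaces and multipliers\<close>

lemma Lp_norm_nonneg: "0 \<le> Lp_norm p u"
  by (simp add: Lp_norm_def)

lemma Lp_norm_cmult:
  assumes "0 < c" and "p \<noteq> 0"
  shows "Lp_norm p (\<lambda>x. c * u x) = c * Lp_norm p u"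
proof -
  have "Lp_norm p (\<lambda>x. c * u x) = (c powr p * (\<integral>x. \<bar>u x\<bar> powr p \<partial>lborel)) powr (1 / p)"
    using assms by (simp add: Lp_norm_def abs_mult powr_mult)
  also have "\<dots> = c * Lp_norm p u"
    using assms by (simp add: Lp_norm_def powr_mult powr_powr)
  finally show ?thesis .
qed

lemma Lp_norm_pos:
  assumes "u \<in> Lp_space p" and "\<not> (AE x in lborel. u x = 0)"
  shows "0 < Lp_norm p u"
proof -
  have int: "integrable lborel (\<lambda>x. \<bar>u x\<bar> powr p)"
    using assms(1) by (simp add: Lp_space_def)
  have "(\<integral>x. \<bar>u x\<bar> powr p \<partial>lborel) \<noteq> 0"
    using assms(2) by (subst integral_nonneg_eq_0_iff_AE[OF int]) auto
  then show ?thesis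
    unfolding Lp_norm_def by simp
qed

lemma Lp_space_cmult: "u \<in> Lp_space p \<Longrightarrow> (\<lambda>x. c * u x) \<in> Lp_space p"
  by (auto simp: Lp_space_def abs_mult powr_mult)

text \<open>The operator acts on the test function, so the scalar leaves both integrals unchanged
  otherwise.\<close>

lemma has_multiplier_cmult:
  assumes "has_multiplier m u v"
  shows "has_multiplier m (\<lambda>x. c * u x) (\<lambda>x. c * v x)"
  using assms unfolding has_multiplier_def by (simp add: mult.assoc)

lemma sobolev_space_cmult:
  "u \<in> sobolev_space \<gamma> p \<Longrightarrow> (\<lambda>x. c * u x) \<in> sobolev_space \<gamma> p"
  unfolding sobolev_space_def using Lp_space_cmult has_multiplier_cmult by blast

lemma has_frac_laplacian_cmult:
  "has_frac_laplacian \<gamma> p u v \<Longrightarrow> has_frac_laplacian \<gamma> p (\<lambda>x. c * u x) (\<lambda>x. c * v x)"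
  unfolding has_frac_laplacian_def using Lp_space_cmult has_multiplier_cmult by blast

section \<open>Positivity of the critical constant\<close>

text \<open>The cone over the unit sphere is the closed unit ball without its centre, which is a
  null set.\<close>

lemma sphere_area_pos: "0 < sphere_area TYPE('a::euclidean_space)"
proof -
  have "{r *\<^sub>R x | r x. 0 < r \<and> r \<le> 1 \<and> x \<in> sphere (0::'a) 1} = cball 0 1 - {0}" (is "?L = ?R")
  proof
    show "?L \<subseteq> ?R" by auto
    show "?R \<subseteq> ?L"
    proof
      fix y :: 'a
      assume "y \<in> ?R"
      then have "y = norm y *\<^sub>R (y /\<^sub>R norm y)" "0 < norm y" "norm y \<le> 1"
        "y /\<^sub>R norm y \<in> sphere 0 1"
        by auto
      then show "y \<in> ?L" by blast
    qed
  qed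
  moreover have "measure lborel (cball (0::'a) 1 - {0}) = measure lborel (cball (0::'a) 1)"
    by (intro measure_Diff_null_set) auto
  ultimately show ?thesis
    by (simp add: sphere_area_def sphere_measure_def content_cball_pos)
qed

lemma beta_0_pos:
  assumes "0 < \<gamma>" and "\<gamma> < real DIM('a)"
  shows "0 < beta_0 TYPE('a::euclidean_space) \<gamma>"
proof -
  have "0 < Gamma (\<gamma> / 2)" "0 < Gamma ((real DIM('a) - \<gamma>) / 2)"
    using assms by (auto intro!: Gamma_real_pos)
  then show ?thesis
    using sphere_area_pos[where 'a='a] by (simp add: beta_0_def Let_def)
qed

section \<open>The Adams integral under null functions and scaling\<close>

text \<open>Since \<gamma> < N, the threshold N / \<gamma> - 1 is positive, so the series has no
  constant term.\<close>

lemma adams_phi_0: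
  assumes "0 < \<gamma>" and "\<gamma> < real N"
  shows "adams_phi N \<gamma> 0 = 0"
proof -
  have "(if real N / \<gamma> - 1 \<le> real j then 0 ^ j / fact j else 0) = (0::real)" for j
    using assms by (cases j) (auto simp: field_simps)
  then show ?thesis
    unfolding adams_phi_def by simp
qed

lemma adams_integral_AE_0:
  fixes u :: "'a::euclidean_space \<Rightarrow> real"
  assumes "0 < \<gamma>" and "\<gamma> < real DIM('a)" and "AE x in lborel. u x = 0"
  shows "adams_integral \<gamma> \<alpha> \<beta> u = 0"
proof -
  have "adams_integral \<gamma> \<alpha> \<beta> u = (\<integral>\<^sup>+(x::'a). 0 \<partial>lborel)"
    unfolding adams_integral_def Let_def
  proof (rule nn_integral_cong_AE)
    show "AE x in lborel. ennreal (adams_phi DIM('a) \<gamma> (\<alpha> * (1 - \<beta> / real DIM('a)) *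
        \<bar>u x\<bar> powr (real DIM('a) / \<gamma> / (real DIM('a) / \<gamma> - 1))) / norm x powr \<beta>) = 0"
      using assms(3) by eventually_elim (simp add: adams_phi_0[OF assms(1,2)])
  qed
  then show ?thesis by simp
qed

text \<open>A dilation of the values is absorbed into the parameter; this trades the critical
  parameter for a subcritical one.\<close>

lemma adams_integral_cmult:
  fixes u :: "'a::euclidean_space \<Rightarrow> real"
  assumes "0 < c" and "p = real DIM('a) / \<gamma>"
  shows "adams_integral \<gamma> \<alpha> \<beta> (\<lambda>x. c * u x) = adams_integral \<gamma> (\<alpha> * c powr (p / (p - 1))) \<beta> u"
  using assms by (simp add: adams_integral_def Let_def abs_mult powr_mult mult_ac)

text \<open>The norm of u is positive and finite, so the denominator in the supremum can be cleared
  in \<open>ennreal\<close>.\<close>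

lemma adams_integral_le_GATA:
  fixes u :: "'a::euclidean_space \<Rightarrow> real"
  assumes p: "p = real DIM('a) / \<gamma>"
    and u: "u \<in> sobolev_space \<gamma> p" "\<not> (AE x in lborel. u x = 0)"
    and v: "has_frac_laplacian \<gamma> p u v" "Lp_norm p v \<le> 1"
  shows "adams_integral \<gamma> \<alpha> \<beta> u
    \<le> GATA TYPE('a) \<gamma> \<alpha> \<beta> * ennreal (Lp_norm p u powr (p * (1 - \<beta> / real DIM('a))))"
    (is "?I \<le> ?G * ennreal ?X")
proof -
  have "u \<in> Lp_space p"
    using u(1) by (simp add: sobolev_space_def)
  then have X: "0 < ?X"
    using Lp_norm_pos u(2) by fastforce
  have "?I / ennreal ?X \<le> ?G"
    unfolding GATA_def Let_def p[symmetric] by (rule SUP_upper) (use u v in blast)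
  then have "?I / ennreal ?X * ennreal ?X \<le> ?G * ennreal ?X"
    by (rule mult_right_mono) simp
  then show ?thesis
    using X by (simp add: ennreal_divide_times mult_divide_eq_ennreal)
qed

section \<open>Elementary inequalities for the constraint\<close>

text \<open>Writing the power as exp (a ln t) gives at least 1 + a ln t, and - ln t \<le> (1 - t) /
  t, where 1 / t \<le> 2. No convexity in t is involved, so small a is covered as well.\<close>

lemma one_minus_powr_le:
  fixes t a :: real
  assumes "1 / 2 \<le> t" and "t \<le> 1" and "0 \<le> a"
  shows "1 - t powr a \<le> 2 * a * (1 - t)"
proof -
  have "1 + a * ln t \<le> t powr a"
    using assms exp_ge_add_one_self[of "a * ln t"] by (simp add: powr_def)
  moreover have "1 - 1 / t \<le> ln t"
    using assms ln_le_minus_one[of "1 / t"] by (simp add: ln_div)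
  moreover have "1 / t - 1 \<le> 2 * (1 - t)"
  proof -
    have "0 \<le> (1 - t) * (2 * t - 1)"
      using assms by simp
    then show ?thesis
      using assms by (simp add: field_simps)
  qed
  ultimately have "1 - t powr a \<le> - (a * ln t)" "- ln t \<le> 2 * (1 - t)"
    by linarith+
  then show ?thesis
    using mult_left_mono[of "- ln t" "2 * (1 - t)" a] assms(3) by (simp add: algebra_simps)
qed

text \<open>Strict positivity of y keeps \<theta> below 1. The cutoff 1/2 keeps t away from 0, so
  that negative powers of t stay bounded later.\<close>

lemma powr_constraint_bound:
  fixes \<theta> y a b p :: real
  assumes "0 \<le> \<theta>" and "0 < y" and "0 < a" and "0 < b" and "b \<le> p"
    and le: "\<theta> powr a + y powr b \<le> 1"
  defines "t \<equiv> max \<theta> (1 / 2)"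
  shows "t < 1" and "y powr p \<le> (2 + 2 * a) * (1 - t)"
proof -
  have yb: "0 < y powr b"
    using assms(2) by simp
  then have "\<theta> powr a < 1 powr a"
    unfolding powr_one_eq_one using le by linarith
  then have "\<theta> < 1"
    using assms(1,3) powr_less_cancel2 by (metis linorder_not_le powr_mono2 less_imp_le zero_le_one)
  then show t1: "t < 1"
    by (simp add: t_def)
  have "y powr b \<le> 1 powr b"
    unfolding powr_one_eq_one using le powr_ge_zero[of \<theta> a] by linarith
  then have "y \<le> 1"
    using assms(2,4) by (metis linorder_not_le powr_less_mono2 zero_le_one)
  \<comment> \<open>For y \<le> 1 the larger exponent gives the smaller power; this is where b \<le>
    p enters.\<close>
  then have "y powr p \<le> y powr b"
    using assms(2,5) by (intro powr_mono') auto
  \<comment> \<open>The summand 2 serves the case t = 1/2, where 2 (1 - t) = 1; the summand 2a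
    serves t = \<theta>.\<close>
  also have "\<dots> \<le> (2 + 2 * a) * (1 - t)"
  proof (cases "\<theta> \<le> 1 / 2")
    case True
    then have "(2 + 2 * a) * (1 - t) = 1 + a" by (simp add: t_def max_def)
    then show ?thesis
      using le powr_ge_zero[of \<theta> a] assms(3) by linarith
  next
    case False
    then have "t = \<theta>" by (simp add: t_def)
    then have "y powr b \<le> 1 - t powr a"
      using le by simp
    also have "\<dots> \<le> 2 * a * (1 - t)"
      using assms(3) t1 by (intro one_minus_powr_le) (auto simp: t_def)
    also have "\<dots> \<le> (2 + 2 * a) * (1 - t)"
      using t1 by (intro mult_right_mono) auto
    finally show ?thesis .
  qed
  finally show "y powr p \<le> (2 + 2 * a) * (1 - t)" .
qed

section \<open>Finiteness of the critical supremum\<close>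

lemma GA_finite:
  fixes \<gamma> p \<beta> a b C :: real
  assumes \<gamma>: "0 < \<gamma>" "\<gamma> < real DIM('a::euclidean_space)"
    and p: "p = real DIM('a) / \<gamma>"
    and \<beta>: "\<beta> < real DIM('a)"
    and ab: "0 < a" "0 < b" "b \<le> p"
    and C: "0 < C"
    and GATA_le: "\<And>\<alpha>. 0 \<le> \<alpha> \<Longrightarrow> \<alpha> < beta_0 TYPE('a) \<gamma> \<Longrightarrow>
      GATA TYPE('a) \<gamma> \<alpha> \<beta> \<le> ennreal (C / (1 - (\<alpha> / beta_0 TYPE('a) \<gamma>) powr ((p - 1) / p))
                                          powr (1 - \<beta> / real DIM('a)))"
  shows "GA TYPE('a) \<gamma> a b \<beta> < \<infinity>"
proof -
  define B where "B = beta_0 TYPE('a) \<gamma>"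
  define s where "s = 1 - \<beta> / real DIM('a)"
  \<comment> \<open>The factor 2 + 2a will bound \<open>y powr p / (1 - t)\<close>, and
    \<open>2 powr p\<close> will bound \<open>(1 / t) powr p\<close>.\<close>
  define K where "K = C * ((2 + 2 * a) * 2 powr p) powr s"
  have B: "0 < B"
    using beta_0_pos \<gamma> by (simp add: B_def)
  have s: "0 < s"
    using \<beta> by (simp add: s_def)
  have p1: "1 < p"
    using \<gamma> by (simp add: p)
  have "adams_integral \<gamma> B \<beta> u \<le> ennreal K"
    if u: "u \<in> sobolev_space \<gamma> p" and v: "has_frac_laplacian \<gamma> p u v"
      and le: "Lp_norm p v powr a + Lp_norm p u powr b \<le> 1" for u v :: "'a \<Rightarrow> real"
  \<comment> \<open>Null functions compete in \<open>GA\<close> but are excluded from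
    \<open>GATA\<close>.\<close>
  proof (cases "AE x in lborel. u x = 0")
    case True
    then show ?thesis
      using adams_integral_AE_0[OF \<gamma> True] by simp
  next
    case False
    define t where "t = max (Lp_norm p v) (1 / 2)"
    define y where "y = Lp_norm p u"
    define w where "w = (\<lambda>x. inverse t * u x)"
    define \<alpha> where "\<alpha> = B * t powr (p / (p - 1))"
    have y: "0 < y"
      unfolding y_def using u False by (intro Lp_norm_pos) (auto simp: sobolev_space_def)
    have t1: "t < 1" and yp: "y powr p \<le> (2 + 2 * a) * (1 - t)"
      using powr_constraint_bound[OF Lp_norm_nonneg[of p v] y ab] le
      by (simp_all add: t_def y_def)
    have t: "1 / 2 \<le> t" "0 < t"
      by (auto simp: t_def)
    have tq: "t powr (p / (p - 1)) < 1"
      using powr_less_mono2[of "p / (p - 1)" t 1] t t1 p1 by simp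
    have \<alpha>: "0 \<le> \<alpha>" "\<alpha> < B"
      using B tq mult_strict_left_mono[OF tq B] by (simp_all add: \<alpha>_def)
    \<comment> \<open>The exponents p / (p - 1) and (p - 1) / p cancel, which turns the denominator
      of the assumed bound into a power of 1 - t.\<close>
    have "(\<alpha> / B) powr ((p - 1) / p) = t"
      using B p1 t by (simp add: \<alpha>_def powr_powr)
    then have G: "GATA TYPE('a) \<gamma> \<alpha> \<beta> \<le> ennreal (C / (1 - t) powr s)"
      using GATA_le[of \<alpha>] \<alpha> by (simp add: B_def s_def)
    have Lw: "Lp_norm p w = y / t"
      using Lp_norm_cmult[of "inverse t" p u] t p1 by (simp add: w_def y_def field_simps)
    have "Lp_norm p (\<lambda>x. inverse t * v x) = Lp_norm p v / t"
      using Lp_norm_cmult[of "inverse t" p v] t p1 by (simp add: field_simps)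
    also have "\<dots> \<le> 1"
      using t by (simp add: t_def)
    finally have Lv: "Lp_norm p (\<lambda>x. inverse t * v x) \<le> 1" .
    have "\<not> (AE x in lborel. w x = 0)"
      using False t by (simp add: w_def)
    then have "adams_integral \<gamma> \<alpha> \<beta> w \<le> GATA TYPE('a) \<gamma> \<alpha> \<beta> * ennreal ((y / t) powr (p * s))"
      using adams_integral_le_GATA[OF p, of w "\<lambda>x. inverse t * v x" \<alpha> \<beta>] Lv u v
      sobolev_space_cmult[of u \<gamma> p "inverse t"] has_frac_laplacian_cmult[of \<gamma> p u v "inverse t"]
      by (simp add: w_def[symmetric] Lw s_def)
    also have "\<dots> \<le> ennreal (C / (1 - t) powr s) * ennreal ((y / t) powr (p * s))"
      using G by (rule mult_right_mono) simp
    also have "\<dots> = ennreal (C / (1 - t) powr s * (y / t) powr (p * s))"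
      using C by (intro ennreal_mult[symmetric]) auto
    \<comment> \<open>Collecting everything under the exponent s pairs 1 - t with the p-th power of
      y, the quantity controlled by the constraint.\<close>
    also have "C / (1 - t) powr s * (y / t) powr (p * s)
        = C * (y powr p / (1 - t) * (1 / t) powr p) powr s"
      using t t1 y by (simp add: powr_mult powr_divide powr_powr)
    also have "\<dots> \<le> K"
      unfolding K_def
    proof (intro mult_left_mono powr_mono2 mult_mono)
      show "y powr p / (1 - t) \<le> 2 + 2 * a"
        using yp t1 by (simp add: pos_divide_le_eq)
      show "1 / t \<le> 2"
        using t by (simp add: field_simps)
    qed (use s C ab t t1 p1 in auto)
    finally have "adams_integral \<gamma> \<alpha> \<beta> w \<le> ennreal K"
      by (simp add: ennreal_leI)
    moreover have "u = (\<lambda>x. t * w x)"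
      using t by (simp add: w_def mult.assoc[symmetric])
    then have "adams_integral \<gamma> B \<beta> u = adams_integral \<gamma> \<alpha> \<beta> w"
      using adams_integral_cmult[OF t(2) p, of B \<beta> w] by (simp add: \<alpha>_def)
    ultimately show ?thesis by simp
  qed
  then have "GA TYPE('a) \<gamma> a b \<beta> \<le> ennreal K"
    unfolding GA_def Let_def p[symmetric] B_def by (intro SUP_least) blast
  then show ?thesis
    using ennreal_less_top order_le_less_trans by (metis infinity_ennreal_def)
qed

theorem theorem1p5:
  fixes N :: nat and \<gamma> p \<beta> a b :: real
  assumes "N = CARD('n::finite)"
    and "0 < \<gamma>" and "\<gamma> < real N"
    and "p = real N / \<gamma>"
    and "0 \<le> \<beta>" and "\<beta> < real N"
    and "0 < a" and "0 < b"
    and "\<And>\<alpha>. 0 \<le> \<alpha> \<Longrightarrow> \<alpha> < beta_0 TYPE(real ^ 'n) \<gamma> \<Longrightarrow> GATA TYPE(real ^ 'n) \<gamma> \<alpha> \<beta> < \<infinity>"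
    and "\<exists>C>0. \<forall>\<alpha>. 0 \<le> \<alpha> \<and> \<alpha> < beta_0 TYPE(real ^ 'n) \<gamma> \<longrightarrow>
           GATA TYPE(real ^ 'n) \<gamma> \<alpha> \<beta>
             \<le> ennreal (C / (1 - (\<alpha> / beta_0 TYPE(real ^ 'n) \<gamma>) powr ((p - 1) / p))
                              powr (1 - \<beta> / real N))"
  shows "(b \<le> p \<longrightarrow> GA TYPE(real ^ 'n) \<gamma> a b \<beta> < \<infinity>) \<and> GA TYPE(real ^ 'n) \<gamma> p p \<beta> < \<infinity>"
proof -
  have N: "real N = real DIM(real ^ 'n)"
    using assms(1) by simp
  obtain C where C: "0 < C" "\<And>\<alpha>. 0 \<le> \<alpha> \<Longrightarrow> \<alpha> < beta_0 TYPE(real ^ 'n) \<gamma> \<Longrightarrow>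
      GATA TYPE(real ^ 'n) \<gamma> \<alpha> \<beta>
        \<le> ennreal (C / (1 - (\<alpha> / beta_0 TYPE(real ^ 'n) \<gamma>) powr ((p - 1) / p))
                         powr (1 - \<beta> / real N))"
    using assms(10) by blast
  \<comment> \<open>The constant C does not depend on the exponents, so one bound serves both (a, b)
    and (p, p).\<close>
  have fin: "GA TYPE(real ^ 'n) \<gamma> a' b' \<beta> < \<infinity>" if "0 < a'" "0 < b'" "b' \<le> p" for a' b'
    using GA_finite[OF assms(2) assms(3,4,6)[unfolded N] that C(1) C(2)[unfolded N]] .
  have "0 < p"
    using assms(2-4) by simp
  then show ?thesis
    using fin assms(7,8) by blast
qed

end
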